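(* For $0<\delta<\frac1{18}$, we have $$\dim_H\left(\mathbf{Bad}(\delta)\right)\ge \frac{\log\left(\left\lfloor \frac1{18\delta}\right\rfloor\right)}{\log\left(\frac1{6\delta}\right)}.$$
   Context: $\dim_H$ denotes Hausdorff dimension and $\lfloor\cdot\rfloor$ the floor function. For $\delta>0$, $\mathbf{Bad}(\delta)$ denotes the set of irrational real numbers $x$ for which there exists an integer $Q>0$ (depending on $x$) such that $|x-p/q|\ge \delta/q^2$ for all integers $q\ge Q$ and all integers $p$ coprime to $q$. *)

theory Defs
  imports "HOL-Analysis.Analysis"
begin

(* The usual conventions for a cover set U: the empty set contributes 0, and a
   nonempty set contributes 1 when s = 0 (0 powr 0 = 0 in HOL, so "powr" alone
   would not count points). *)
definition hausdorff_gauge :: "real \<Rightarrow> 'a::metric_space set \<Rightarrow> ennreal" where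
  "hausdorff_gauge s U =
    (if U = {} then 0 else if s = 0 then 1 else ennreal (diameter U powr s))"

(* Boundedness is required explicitly because "diameter" is real-valued and thus
   unspecified on unbounded sets. A finite cover is a sequence that is eventually empty. *)
definition hausdorff_premeasure :: "real \<Rightarrow> real \<Rightarrow> 'a::metric_space set \<Rightarrow> ennreal" where
  "hausdorff_premeasure s \<epsilon> A =
    (INF U \<in> {U :: nat \<Rightarrow> 'a set.
                A \<subseteq> (\<Union>i. U i) \<and> (\<forall>i. bounded (U i) \<and> diameter (U i) \<le> \<epsilon>)}.
       \<Sum>i. hausdorff_gauge s (U i))"

(* The supremum over positive mesh sizes is the limit as the mesh tends to 0, since the
   premeasure is antitone in the mesh. *)
definition hausdorff_measure :: "real \<Rightarrow> 'a::metric_space set \<Rightarrow> ennreal" where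
  "hausdorff_measure s A = (SUP \<epsilon> \<in> {0<..}. hausdorff_premeasure s \<epsilon> A)"

(* Extended-real valued, so that the dimension is \<infinity> if no measure vanishes. *)
definition hausdorff_dim :: "'a::metric_space set \<Rightarrow> ereal" where
  "hausdorff_dim A = (INF s \<in> {s. 0 \<le> s \<and> hausdorff_measure s A = 0}. ereal s)"

definition Bad :: "real \<Rightarrow> real set" where
  "Bad \<delta> = {x. x \<notin> \<rat> \<and>
     (\<exists>Q::int. Q > 0 \<and>
       (\<forall>q p :: int. q \<ge> Q \<longrightarrow> coprime p q \<longrightarrow>
          \<bar>x - real_of_int p / real_of_int q\<bar> \<ge> \<delta> / (real_of_int q)\<^sup>2))}"

end

(* Put r = 6 delta, m = floor(1 / (3 r)), s = ln m / ln (1 / r). Intervals of level n have length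
   r^n / 3. Each contains m disjoint groups of three consecutive intervals of length r^(n+1) / 3.
   Two distinct fractions whose denominators satisfy r^(n+1) q^2 < 1 are more than r^(n+1), the
   width of a group, apart; if also 1 <= r^n q^2, the zone |x - p/q| < delta / q^2 is at most
   r^(n+1) / 3, the width of one interval, wide. So some third of every group misses all zones
   of level n. Keeping that third gives a Cantor set in Bad(delta); it avoids all fractions, hence
   consists of irrationals. The base-m digits of u in [0,1] select a point of it. The children of an
   interval stay in order, so close points have close addresses, and the inverse of
   this parametrisation is s-Hoelder onto [0,1]; thus a cover of the Cantor set induces a cover
   of [0,1], and Lebesgue measure plays the role of the mass distribution. *)

theory Submission
  imports Defs
begin

section \<open>Dimension bound from a parametrisation with Hoelder inverse\<close>

lemma hausdorff_dim_ge_of_Hoelder: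
  fixes g :: "real \<Rightarrow> 'a::metric_space"
  assumes g: "g ` {0..1} \<subseteq> A" and C: "C > 0"
    and H: "\<And>u v. u \<in> {0..1} \<Longrightarrow> v \<in> {0..1} \<Longrightarrow> \<bar>u - v\<bar> \<le> C * dist (g u) (g v) powr s"
  shows "hausdorff_dim A \<ge> ereal s"
  unfolding hausdorff_dim_def
proof (rule INF_greatest, clarify)
  fix t :: real
  assume t: "0 \<le> t" and zero: "hausdorff_measure t A = 0"
  show "ereal s \<le> ereal t"
  proof (rule ccontr)
    assume "\<not> ereal s \<le> ereal t"
    then have ts: "t < s" by simp
    \<comment> \<open>Mesh 1 is fine enough: it keeps diameters at most 1, so lowering the exponent
      from \<open>s\<close> to \<open>t\<close> can only enlarge their powers.\<close>
    have "1 \<le> ennreal (2 * C) * (\<Sum>i. hausdorff_gauge t (U i))"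
      if cov: "A \<subseteq> (\<Union>i. U i)" and bd: "\<And>i. bounded (U i)" and d1: "\<And>i. diameter (U i) \<le> 1"
      for U :: "nat \<Rightarrow> 'a set"
    proof -
      define V where "V i = {u \<in> {0..1}. g u \<in> U i}" for i
      define e where "e i = C * diameter (U i) powr s" for i
      \<comment> \<open>The preimage \<open>V i\<close> need not be measurable, so a ball around one
        of its points, with radius from the Hoelder bound, replaces it.\<close>
      define W where "W i = (if V i = {} then {} else cball (SOME u. u \<in> V i) (e i))" for i
      have e0: "e i \<ge> 0" for i using C by (simp add: e_def)
      have VW: "V i \<subseteq> W i" for i
      proof
        fix v assume v: "v \<in> V i"
        define u where "u = (SOME u. u \<in> V i)"
        have u: "u \<in> V i" unfolding u_def using v by (rule someI)
        have "dist (g u) (g v) \<le> diameter (U i)"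
          using u v bd by (auto simp: V_def intro: diameter_bounded_bound)
        then have "dist (g u) (g v) powr s \<le> diameter (U i) powr s"
          using t ts by (intro powr_mono2) auto
        then have "\<bar>u - v\<bar> \<le> e i"
          using H[of u v] u v C unfolding e_def V_def
          by (smt (verit) mem_Collect_eq mult_left_mono)
        with v show "v \<in> W i" by (auto simp: W_def u_def dist_real_def)
      qed
      have eW: "emeasure lborel (W i) \<le> ennreal (2 * C) * hausdorff_gauge t (U i)" for i
      proof (cases "V i = {}")
        case False
        then have ne: "U i \<noteq> {}" by (auto simp: V_def)
        have d0: "0 \<le> diameter (U i)" using bd diameter_ge_0 by blast
        have "ennreal (diameter (U i) powr s) \<le> hausdorff_gauge t (U i)"
        \<comment> \<open>At exponent 0 the gauge of a nonempty set is 1 and not a power, so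
          monotonicity in the exponent does not cover this case.\<close>
        proof (cases "t = 0")
          case True
          then show ?thesis using ne d0 d1[of i] ts by (simp add: hausdorff_gauge_def powr_le1)
        next
          case False
          have "diameter (U i) powr s \<le> diameter (U i) powr t"
            using d0 d1[of i] ts by (intro powr_mono') auto
          then show ?thesis using ne False by (simp add: hausdorff_gauge_def ennreal_leI)
        qed
        moreover have "emeasure lborel (W i) = ennreal (2 * C) * ennreal (diameter (U i) powr s)"
        proof -
          have "emeasure lborel (W i) = ennreal (2 * e i)"
            using False e0[of i] by (simp add: W_def cball_eq_atLeastAtMost)
          then show ?thesis using C by (simp add: e_def ennreal_mult mult.assoc)
        qed
        ultimately show ?thesis by (simp add: mult_left_mono)
      qed (simp add: W_def)
      have "{0..1} \<subseteq> (\<Union>i. W i)"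
      proof
        fix u :: real assume u: "u \<in> {0..1}"
        then have "g u \<in> (\<Union>i. U i)" using g cov by blast
        then obtain i where "g u \<in> U i" by blast
        then show "u \<in> (\<Union>i. W i)" using u VW[of i] by (auto simp: V_def)
      qed
      moreover have W: "range W \<subseteq> sets lborel" by (auto simp: W_def)
      ultimately have "emeasure lborel {0..1::real} \<le> emeasure lborel (\<Union>i. W i)"
        by (intro emeasure_mono) auto
      also have "\<dots> \<le> (\<Sum>i. emeasure lborel (W i))"
        by (rule emeasure_subadditive_countably[OF W])
      also have "\<dots> \<le> (\<Sum>i. ennreal (2 * C) * hausdorff_gauge t (U i))"
        by (intro suminf_le eW) auto
      finally show ?thesis by simp
    qed
    then have "1 / ennreal (2 * C) \<le> hausdorff_premeasure t 1 A"
      unfolding hausdorff_premeasure_def using C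
      by (intro INF_greatest) (auto simp: divide_le_posI_ennreal)
    also have "\<dots> \<le> hausdorff_measure t A"
      unfolding hausdorff_measure_def by (intro SUP_upper) auto
    finally show False using zero C by (simp add: ennreal_divide_eq_0_iff)
  qed
qed

section \<open>Separation of fractions and safe thirds\<close>

lemma rational_distance_ge:
  fixes p q p' q' :: int
  assumes "q > 0" "q' > 0" "real_of_int p / q \<noteq> p' / q'"
    and "N * (real_of_int q)\<^sup>2 < 1" "N * (real_of_int q')\<^sup>2 < 1" "N > 0"
  shows "\<bar>real_of_int p / q - p' / q'\<bar> > N"
proof -
  \<comment> \<open>A nonzero integer has modulus at least 1, so the fractions differ by at least 1
    / (q q').\<close>
  have "p * q' - p' * q \<noteq> 0"
    using assms(1-3) by (simp add: field_simps flip: of_int_mult)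
  then have "1 \<le> \<bar>real_of_int (p * q' - p' * q)\<bar>" by linarith
  moreover have "N * (real_of_int q * q') < 1"
  proof -
    have "real_of_int q * q' \<le> (max (real_of_int q) q')\<^sup>2"
      unfolding power2_eq_square using assms(1,2) by (intro mult_mono) auto
    then have "N * (real_of_int q * q') \<le> N * (max (real_of_int q) q')\<^sup>2"
      using assms(6) by simp
    also have "\<dots> < 1" using assms(4,5) by (auto simp: max_def)
    finally show ?thesis .
  qed
  moreover have "real_of_int p / q - p' / q' = real_of_int (p * q' - p' * q) / (real_of_int q * q')"
    using assms(1,2) by (simp add: field_simps)
  ultimately show ?thesis
    using assms(1,2) by (simp add: abs_mult pos_less_divide_eq)
qed

text \<open>For 0 < r < 1 the blocks r^-n \<le> q^2 < r^-(n+1) exhaust all q > 0. The constant r / 6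
  is \<delta>.\<close>

definition safe :: "real \<Rightarrow> nat \<Rightarrow> real \<Rightarrow> bool" where
  "safe r n x \<longleftrightarrow> (\<forall>(p :: int) (q :: int). q > 0 \<longrightarrow> 1 \<le> r ^ n * (real_of_int q)\<^sup>2 \<longrightarrow>
     r ^ Suc n * (real_of_int q)\<^sup>2 < 1 \<longrightarrow> r / 6 / (real_of_int q)\<^sup>2 \<le> \<bar>x - real_of_int p / real_of_int q\<bar>)"

text \<open>Otherwise each of the three thirds, of width w, has a fraction less than w / 2 away.
  Fractions for adjacent thirds are less than 3 w apart, hence equal; but the first lies below b + 3
  w / 2 and the last above it.\<close>

lemma safe_third_exists:
  fixes r b :: real
  assumes r: "r > 0"
  shows "\<exists>c\<in>{0..2}. \<forall>x\<in>{b + c * (r ^ Suc n / 3)..b + (c + 1) * (r ^ Suc n / 3)}. safe r n x"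
proof (rule ccontr)
  assume contra: "\<not> ?thesis"
  define w where "w = r ^ Suc n / 3"
  have w: "w > 0" "r ^ Suc n = 3 * w" using r by (auto simp: w_def)
  define S where "S = {real_of_int p / q | p q :: int.
     q > 0 \<and> r ^ Suc n * (real_of_int q)\<^sup>2 < 1}"
  have sep: "x = y" if "x \<in> S" "y \<in> S" "\<bar>x - y\<bar> \<le> 3 * w" for x y
    using that rational_distance_ge[where N = "3 * w"] w unfolding S_def
    by (smt (verit) mem_Collect_eq)
  have hit: "\<exists>y\<in>S. b + c * w - w / 2 < y \<and> y < b + (c + 1) * w + w / 2" if c: "c \<in> {0..2}" for c
  proof -
    obtain x where x: "x \<in> {b + c * w..b + (c + 1) * w}" "\<not> safe r n x"
      using contra c unfolding w_def by blast
    then obtain p q :: int where pq: "q > 0" "1 \<le> r ^ n * (real_of_int q)\<^sup>2"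
        "r ^ Suc n * (real_of_int q)\<^sup>2 < 1" "\<bar>x - p / q\<bar> < r / 6 / (real_of_int q)\<^sup>2"
      unfolding safe_def by (auto simp: not_le)
    have "r / 6 / (real_of_int q)\<^sup>2 \<le> r / 6 * r ^ n"
      using pq(1,2) r by (simp add: divide_le_eq mult.assoc)
    also have "\<dots> = w / 2" by (simp add: w_def)
    finally have "\<bar>x - p / q\<bar> < w / 2" using pq(4) by linarith
    moreover have "real_of_int p / q \<in> S" unfolding S_def using pq by blast
    moreover have "b + c * w \<le> x" "x \<le> b + (c + 1) * w" using x(1) by simp_all
    ultimately show ?thesis by (intro bexI[of _ "real_of_int p / q"] conjI) linarith+
  qed
  from hit[of 0] hit[of 1] hit[of 2] obtain x y z where S: "x \<in> S" "y \<in> S" "z \<in> S"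
    and b: "b - w / 2 < x" "x < b + w + w / 2" "b + w - w / 2 < y" "y < b + 2 * w + w / 2"
      "b + 2 * w - w / 2 < z" "z < b + 3 * w + w / 2"
    by auto
  have "x = y" "y = z" using b w(1) by (auto intro!: sep S)
  then show False using b by simp
qed

section \<open>The Cantor construction\<close>

locale cantor =
  fixes r :: real and m :: int
  assumes r: "0 < r" and m: "2 \<le> m" and mr: "3 * real_of_int m * r \<le> 1"
begin

text \<open>The offset may be any real in [0, 2], not only 0, 1 or 2; this still keeps the interval
  inside its group.\<close>

definition safe_third :: "nat \<Rightarrow> real \<Rightarrow> real" where
  "safe_third n b = (SOME c. c \<in> {0..2} \<and>
     (\<forall>x\<in>{b + c * (r ^ Suc n / 3)..b + (c + 1) * (r ^ Suc n / 3)}. safe r n x))"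

lemma safe_third:
  "safe_third n b \<in> {0..2}"
  "x \<in> {b + safe_third n b * (r ^ Suc n / 3)..b + (safe_third n b + 1) * (r ^ Suc n / 3)}
     \<Longrightarrow> safe r n x"
  using someI_ex[OF safe_third_exists[OF r, of b n, unfolded Bex_def]]
  unfolding safe_third_def by blast+

text \<open>Left endpoint of interval \<open>k\<close> of level \<open>n\<close>:
  \<open>k div m\<close> is its parent, \<open>k mod m\<close> its group. Letting \<open>k\<close>
  range over all integers gives every interval a right neighbour, and \<open>u = 1\<close> an
  address.\<close>

fun corner :: "nat \<Rightarrow> int \<Rightarrow> real" where
  "corner 0 k = k / 3"
| "corner (Suc n) k =
     (let b = corner n (k div m) + (k mod m) * r ^ Suc n in b + safe_third n b * (r ^ Suc n / 3))"

lemma corner_Suc_ge: "corner n (k div m) + (k mod m) * r ^ Suc n \<le> corner (Suc n) k"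
  using safe_third(1) r by (auto simp: Let_def)

lemma corner_Suc_le:
  "corner (Suc n) k + r ^ Suc n / 3 \<le> corner n (k div m) + (k mod m + 1) * r ^ Suc n"
proof -
  define b where "b = corner n (k div m) + (k mod m) * r ^ Suc n"
  have "(safe_third n b + 1) * (r ^ Suc n / 3) \<le> 3 * (r ^ Suc n / 3)"
    using safe_third(1)[of n b] r by (intro mult_right_mono) auto
  moreover have "corner (Suc n) k = b + safe_third n b * (r ^ Suc n / 3)"
    by (simp add: b_def Let_def)
  ultimately show ?thesis unfolding b_def by (simp add: algebra_simps)
qed

text \<open>This is what \<open>mr\<close> is for: \<open>m\<close> groups of width r^(n+1) fit into
  a parent of length r^n / 3.\<close>

lemma children_fit:
  assumes "i \<le> m" shows "real_of_int i * r ^ Suc n \<le> r ^ n / 3"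
proof -
  have "real_of_int i * r ^ Suc n \<le> real_of_int m * r ^ Suc n"
    using assms r by (intro mult_right_mono) auto
  also have "\<dots> = (3 * real_of_int m * r) * (r ^ n / 3)" by simp
  also have "\<dots> \<le> 1 * (r ^ n / 3)" using mr r by (intro mult_right_mono) auto
  finally show ?thesis by simp
qed

lemma corner_nested:
  "corner n (k div m) \<le> corner (Suc n) k"
  "corner (Suc n) k + r ^ Suc n / 3 \<le> corner n (k div m) + r ^ n / 3"
proof -
  have "0 \<le> real_of_int (k mod m) * r ^ Suc n" using m r by simp
  then show "corner n (k div m) \<le> corner (Suc n) k" using corner_Suc_ge[of n k] by linarith
  have "real_of_int (k mod m + 1) * r ^ Suc n \<le> r ^ n / 3"
    using m by (intro children_fit) (simp add: add1_zle_eq)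
  then show "corner (Suc n) k + r ^ Suc n / 3 \<le> corner n (k div m) + r ^ n / 3"
    using corner_Suc_le[of n k] by simp
qed

text \<open>Siblings lie in consecutive groups. After a last child the index carries over to the
  next parent, and nesting reduces the claim to the parents.\<close>

lemma corner_step: "corner n k + r ^ n / 3 \<le> corner n (k + 1)"
proof (induction n arbitrary: k)
  case 0
  then show ?case by (simp add: field_simps)
next
  case (Suc n)
  show ?case
  proof (cases "k mod m = m - 1")
    case True
    have "k + 1 = m * (k div m + 1)"
      using True mult_div_mod_eq[of m k] unfolding distrib_left by linarith
    then have "(k + 1) div m = k div m + 1" using m by simp
    then show ?thesis
      using corner_nested[of n "k + 1"] corner_nested[of n k] Suc[of "k div m"] by simp
  next
    case False
    have "k mod m < m" "0 \<le> k mod m" using m by auto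
    then have *: "k mod m + 1 < m" using False by linarith
    have k: "k + 1 = m * (k div m) + (k mod m + 1)" using mult_div_mod_eq[of m k] by linarith
    have "(k + 1) div m = k div m" "(k + 1) mod m = k mod m + 1"
      using int_div_pos_eq[OF k] int_mod_pos_eq[OF k] * \<open>0 \<le> k mod m\<close> by linarith+
    then show ?thesis using corner_Suc_ge[of n "k + 1"] corner_Suc_le[of n k] by simp
  qed
qed

lemma corner_mono: "corner n k + real j * (r ^ n / 3) \<le> corner n (k + int j)"
proof (induction j)
  case (Suc j)
  then show ?case using corner_step[of n "k + int j"] by (simp add: algebra_simps add_divide_distrib)
qed simp

section \<open>Parametrisation by base-m digits\<close>

definition address :: "real \<Rightarrow> nat \<Rightarrow> int" where
  "address u n = \<lfloor>real_of_int m ^ n * u\<rfloor>"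

lemma address_Suc: "address u (Suc n) div m = address u n"
proof -
  have "address u (Suc n) div m = \<lfloor>real_of_int m ^ Suc n * u / real_of_int m\<rfloor>"
    unfolding address_def using m by (intro floor_divide_real_eq_div[symmetric]) simp
  then show ?thesis using m by (simp add: address_def)
qed

definition point :: "real \<Rightarrow> real" where
  "point u = (SUP n. corner n (address u n))"

text \<open>Along the addresses of \<open>u\<close> the left endpoints increase and the right ones
  decrease, so the supremum lies in every interval.\<close>

lemma point_bounds:
  "corner n (address u n) \<le> point u" "point u \<le> corner n (address u n) + r ^ n / 3"
proof -
  define a where "a n = corner n (address u n)" for n
  have "a n \<le> a (Suc n)" "a (Suc n) + r ^ Suc n / 3 \<le> a n + r ^ n / 3" for n
    using corner_nested[of n "address u (Suc n)"] by (simp_all only: a_def address_Suc)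
  then have a: "incseq a" "decseq (\<lambda>n. a n + r ^ n / 3)"
    by (auto intro: incseq_SucI decseq_SucI)
  have le: "a i \<le> a j + r ^ j / 3" for i j
  proof -
    have "a i \<le> a (max i j)" using a(1) by (simp add: incseq_def)
    also have "\<dots> \<le> a (max i j) + r ^ max i j / 3" using r by simp
    also have "\<dots> \<le> a j + r ^ j / 3" using decseqD[OF a(2), of j "max i j"] by simp
    finally show ?thesis .
  qed
  then have "bdd_above (range a)" by (auto intro!: bdd_aboveI[of _ "a 0 + r ^ 0 / 3"])
  then have "a n \<le> (SUP n. a n)" "(SUP n. a n) \<le> a n + r ^ n / 3"
    using le by (auto intro: cSUP_upper cSUP_least)
  then show "corner n (address u n) \<le> point u" "point u \<le> corner n (address u n) + r ^ n / 3"
    by (simp_all add: a_def point_def)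
qed

text \<open>Safety of level \<open>n\<close> comes from the interval of level \<open>n + 1\<close>,
  which was placed to be safe.\<close>

lemma point_safe: "safe r n (point u)"
proof -
  define b where "b = corner n (address u n) + (address u (Suc n) mod m) * r ^ Suc n"
  have "corner (Suc n) (address u (Suc n)) = b + safe_third n b * (r ^ Suc n / 3)"
    by (simp add: b_def Let_def address_Suc)
  then have "point u \<in> {b + safe_third n b * (r ^ Suc n / 3)..b + (safe_third n b + 1) * (r ^ Suc n / 3)}"
    using point_bounds[where n = "Suc n" and u = u] by (simp add: distrib_right add.assoc add_divide_distrib del: power_Suc)
  then show ?thesis by (rule safe_third(2))
qed

lemma r_lt_1: "r < 1"
proof -
  have "6 * r \<le> 3 * real_of_int m * r" using m r by (intro mult_right_mono) auto
  then show ?thesis using mr r by linarith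
qed

text \<open>The first power of \<open>r\<close> below \<open>t\<close> is not r^0, as t \<le> 1;
  \<open>n\<close> is the exponent before it. With t = 1 / q^2 this is the level that handles
  \<open>q\<close>.\<close>

lemma scale_exists:
  fixes t :: real assumes "0 < t" "t \<le> 1"
  obtains n where "r ^ Suc n < t" "t \<le> r ^ n"
proof -
  obtain n0 where "r ^ n0 < t" using real_arch_pow_inv[OF assms(1) r_lt_1] by blast
  then obtain n where n: "r ^ n < t" "\<And>i. i < n \<Longrightarrow> \<not> r ^ i < t"
    using exists_least_iff[of "\<lambda>n. r ^ n < t"] by blast
  then have "n \<noteq> 0" using assms by (auto intro: ccontr)
  then obtain j where "n = Suc j" using not0_implies_Suc by blast
  then show ?thesis using n that[of j] by (simp add: not_less)
qed

lemma point_badly_approximable: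
  fixes p q :: int
  assumes q: "q > 0"
  shows "r / 6 / (real_of_int q)\<^sup>2 \<le> \<bar>point u - p / q\<bar>"
proof -
  have "1 \<le> (real_of_int q)\<^sup>2" using q by simp
  then have "0 < 1 / (real_of_int q)\<^sup>2" "1 / (real_of_int q)\<^sup>2 \<le> 1" using q by simp_all
  then obtain n where "r ^ Suc n < 1 / (real_of_int q)\<^sup>2" "1 / (real_of_int q)\<^sup>2 \<le> r ^ n"
    by (rule scale_exists)
  then have "r ^ Suc n * (real_of_int q)\<^sup>2 < 1" "1 \<le> r ^ n * (real_of_int q)\<^sup>2"
    using q by (simp_all add: field_simps)
  then show ?thesis using point_safe[of n u] q unfolding safe_def by blast
qed

lemma point_in_Bad: "point u \<in> Bad (r / 6)"
proof -
  have "point u \<notin> \<rat>"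
  proof
    assume "point u \<in> \<rat>"
    then obtain p q :: int where "q > 0" "point u = p / q" by (rule Rats_cases')
    then show False using point_badly_approximable[of q u p] r by (simp add: divide_le_0_iff)
  qed
  then show ?thesis unfolding Bad_def using point_badly_approximable
    by (auto intro!: exI[of _ 1])
qed

section \<open>Hoelder estimate for the inverse\<close>

lemma close_addresses:
  assumes "u \<le> v" "\<bar>point u - point v\<bar> \<le> r ^ n / 3"
  shows "v - u \<le> 3 / real_of_int m ^ n"
proof -
  have mn: "real_of_int m ^ n > 0" using m by simp
  \<comment> \<open>Addresses 3 or more apart would leave a gap of at least 2 r^n / 3 between the
    points.\<close>
  have "address v n \<le> address u n + 2"
  proof (rule ccontr)
    assume "\<not> ?thesis"
    then have "\<exists>j. address v n = address u n + int j \<and> j \<ge> 3"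
      by (intro exI[of _ "nat (address v n - address u n)"]) auto
    then obtain j where j: "address v n = address u n + int j" "j \<ge> 3" by blast
    have "3 * (r ^ n / 3) \<le> real j * (r ^ n / 3)" using j(2) r by (intro mult_right_mono) auto
    then show False
      using zero_less_power[OF r, of n] corner_mono[of n "address u n" j] j(1) point_bounds[where n = n and u = u] point_bounds[where n = n and u = v] assms(2)
        \<open>3 * (r ^ n / 3) \<le> real j * (r ^ n / 3)\<close>
      by (simp only:)
  qed
  then have "real_of_int m ^ n * v - real_of_int m ^ n * u \<le> 3"
    unfolding address_def by linarith
  then have "(v - u) * real_of_int m ^ n \<le> 3" by (simp add: algebra_simps)
  then show ?thesis using mn by (simp add: pos_le_divide_eq)
qed

text \<open>The exponent is chosen so that r^s = 1 / m. In the constant, 3 comes from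
  \<open>close_addresses\<close>, \<open>m\<close> from passing from level \<open>n\<close> to
  \<open>n + 1\<close>, and 3^s from interval lengths being r^n / 3.\<close>

lemma point_inverse_Hoelder:
  defines "s \<equiv> ln (real_of_int m) / ln (1 / r)"
  assumes uv: "u \<in> {0..1}" "v \<in> {0..1}"
  shows "\<bar>u - v\<bar> \<le> 3 * m * 3 powr s * dist (point u) (point v) powr s"
  using uv
proof (induction u v rule: linorder_wlog)
  case (le u v)
  have s: "s \<ge> 0" using m r r_lt_1 by (simp add: s_def)
  have "r powr s = 1 / m"
  proof -
    have "s * ln r = - ln (real_of_int m)" using r r_lt_1 by (simp add: s_def ln_div)
    then show ?thesis using r m by (simp add: powr_def exp_minus inverse_eq_divide)
  qed
  then have pow: "(r ^ n) powr s = 1 / real_of_int m ^ n" for n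
    using r by (induction n) (simp_all add: powr_mult)
  define t where "t = 3 * dist (point u) (point v)"
  have main: "\<bar>u - v\<bar> \<le> 3 * m * t powr s"
  \<comment> \<open>Only 0 < t \<le> 1 has a matching level. For t = 0 every level applies; for t >
    1 the bound exceeds the length of [0, 1].\<close>
  proof (cases "t = 0 \<or> t > 1")
    case True
    then show ?thesis
    proof
      assume t: "t = 0"
      have "v - u \<le> 3 / real_of_int m ^ n" for n
        using close_addresses[of u v n] le(1) t r by (simp add: t_def)
      moreover have "(\<lambda>n. 3 / real_of_int m ^ n) \<longlonglongrightarrow> 0"
        using m by (intro LIMSEQ_divide_realpow_zero) auto
      ultimately have "v - u \<le> 0" by (meson LIMSEQ_le_const)
      then show ?thesis using le(1) t by simp
    next
      assume t: "t > 1"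
      have "\<bar>u - v\<bar> \<le> 1" using le by auto
      moreover have "1 * 1 \<le> (3 * m) * t powr s"
        using m t s by (intro mult_mono) (auto simp: ge_one_powr_ge_zero)
      ultimately show ?thesis by simp
    qed
  next
    case False
    then have "0 < t" "t \<le> 1" by (auto simp: t_def)
    then obtain n where n: "r ^ Suc n < t" "t \<le> r ^ n" by (rule scale_exists)
    have "v - u \<le> 3 / real_of_int m ^ n"
      using close_addresses[of u v n] le(1) n(2) by (simp add: t_def dist_real_def)
    also have "\<dots> = 3 * m * (r ^ Suc n) powr s" using m by (simp add: pow del: power_Suc) simp
    also have "\<dots> \<le> 3 * m * t powr s"
      using m n(1) s r by (intro mult_left_mono powr_mono2) auto
    finally show ?thesis using le(1) by simp
  qed
  then show ?case using s by (simp add: t_def powr_mult)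
next
  case (sym u v)
  then show ?case by (simp add: abs_minus_commute dist_commute)
qed

end

theorem theorem1p11:
  fixes \<delta> :: real
  assumes "0 < \<delta>" and "\<delta> < 1 / 18"
  shows "hausdorff_dim (Bad \<delta>) \<ge>
    ereal (ln (real_of_int \<lfloor>1 / (18 * \<delta>)\<rfloor>) / ln (1 / (6 * \<delta>)))"
proof (cases "\<lfloor>1 / (18 * \<delta>)\<rfloor> \<ge> 2")
  case True
  define m where "m = \<lfloor>1 / (18 * \<delta>)\<rfloor>"
  have "real_of_int m \<le> 1 / (18 * \<delta>)" by (simp add: m_def)
  then have "3 * real_of_int m * (6 * \<delta>) \<le> 1" using assms(1) by (simp add: field_simps)
  then interpret cantor "6 * \<delta>" m
    using assms(1) True by unfold_locales (simp_all add: m_def)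
  show ?thesis
    unfolding m_def[symmetric]
    by (rule hausdorff_dim_ge_of_Hoelder[OF _ _ point_inverse_Hoelder])
       (use m point_in_Bad in auto)
next
  case False
  have "1 / (18 * \<delta>) > 1" using assms by simp
  \<comment> \<open>With floor 1 the claimed bound is ln 1 = 0 up to a factor, and the infimum runs
    over nonnegative exponents.\<close>
  then have "\<lfloor>1 / (18 * \<delta>)\<rfloor> = 1" using False by linarith
  then show ?thesis by (auto simp: hausdorff_dim_def intro!: INF_greatest)
qed

end
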